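(* Let $A$ be a commutative ring, $R=A[\xi_i]_{i\ge1}$, let $\lambda$ be an $\infty$-composition on an index set $\mathcal{I}$, let $e$ be a weighting on $\mathcal{I}$, and let $Z$ be a subset of $\mathbf{U}^{\mathcal{I}}$. Then: (a) The (ordinary) radical of $\mathfrak{P}(\lambda,e;Z)$ is $\mathfrak{P}(\lambda;Z)$. (b) The $\mathfrak{S}$-radical of $\mathfrak{P}(\lambda,e;Z)$ is $\mathfrak{P}(\lambda,\operatorname{red}_\lambda(e);Z)$. (c) If $Z=\bigcup_{i\in I}Z_i$ for a family of subsets $Z_i\subset\mathbf{U}^{\mathcal{I}}$, then $\mathfrak{P}(\lambda,e;Z)=\bigcap_{i\in I}\mathfrak{P}(\lambda,e;Z_i)$.
   Context: $[\infty]=\{1,2,\ldots\}$; $\mathfrak{S}=\bigcup_{n\ge1}\mathfrak{S}_n$ is the group of permutations of $[\infty]$ moving finitely many elements, acting on $R$ by $A$-algebra automorphisms permuting the $\xi_i$. An $\mathfrak{S}$-ideal is an $\mathfrak{S}$-stable ideal. The $\mathfrak{S}$-radical of an $\mathfrak{S}$-ideal $\mathfrak{a}$ is the sum of all $\mathfrak{S}$-ideals $\mathfrak{b}$ with $\mathfrak{b}^n\subset\mathfrak{a}$ for some $n$. An $\infty$-composition on a finite index set $\mathcal{I}$ is a function $\lambda\colon\mathcal{I}\to\mathbf{Z}_{\ge1}\cup\{\infty\}$ taking the value $\infty$ at least once. A weighting on $\mathcal{I}$ is a function $e\colon\mathcal{I}\to\mathbf{Z}_{\ge1}$; its reduction $\operatorname{red}_\lambda(e)$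 is the weighting equal to $e_\alpha$ when $\lambda_\alpha=\infty$ and to $1$ when $\lambda_\alpha<\infty$. A partition of $[\infty]$ of type $\lambda$ is a family $\mathcal{U}=\{U_\alpha\}_{\alpha\in\mathcal{I}}$ of disjoint non-empty subsets covering $[\infty]$ with $\#U_\alpha=\lambda_\alpha$; $\pi\colon[\infty]\to\mathcal{I}$ is given by $i\in U_{\pi(i)}$. Let $\tilde{S}_{\mathcal{U},0}=A[t_\alpha]_{\alpha\in\mathcal{I}}[(t_\alpha-t_\beta)^{-1}]_{\alpha\ne\beta}$, $\mathbf{U}^{\mathcal{I}}=\operatorname{Spec}(\tilde{S}_{\mathcal{U},0})$, $\tilde{S}_{\mathcal{U}}=\tilde{S}_{\mathcal{U},0}[\epsilon_i]_{i\ge1}$. For a subset $Z\subset\mathbf{U}^{\mathcal{I}}$ (set of scheme-theoretic points) let $\mathfrak{I}_0(Z)\subset\tilde{S}_{\mathcal{U},0}$ be its radical ideal (intersection of the primes in $Z$), and let $\mathfrak{Q}_{\mathcal{U}}(\lambda,e;Z)$ be the ideal of $\tilde{S}_{\mathcal{U}}$ generated by $\mathfrak{I}_0(Z)$ and all $\epsilon_i^{e(\pi(i))}$, $i\ge1$. Let $\iota\colon R\to\tilde{S}_{\mathcal{U}}$ be the $A$-algebra map $\xi_i\mapsto t_{\pi(i)}+\epsilon_i$. Then $\mathfrak{P}(\lambda,e;Z)=\{f\in R:\iota(\sigma f)\in\mathfrak{Q}_{\mathcal{U}}(\lambda,e;Z)\text{ for all }\sigma\in\mathfrak{S}\}$,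 which is independent of the choice of $\mathcal{U}$ of type $\lambda$. $\mathfrak{P}(\lambda;Z)$ means $\mathfrak{P}(\lambda,e;Z)$ with $e=1$ identically. *)

theory Defs
  imports
    "HOL-Library.Poly_Mapping"
    "HOL-Library.Extended_Nat"
    "HOL-Library.Disjoint_Sets"
    "HOL-Combinatorics.Perm"
begin

unbundle permutation_syntax


section \<open>Ideals of a commutative ring\<close>

text \<open>Ideals are the submodules of the ring over itself, and the ideal generated by a set is
  the submodule spanned by it.\<close>

lemma module_times: "module (times :: 'r \<Rightarrow> 'r \<Rightarrow> 'r::comm_ring_1)"
  by standard (simp_all add: algebra_simps)

abbreviation is_ideal :: "'r::comm_ring_1 set \<Rightarrow> bool" where
  "is_ideal \<equiv> module.subspace times"

abbreviation ideal_gen :: "'r::comm_ring_1 set \<Rightarrow> 'r set" where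
  "ideal_gen \<equiv> module.span times"

definition prime_ideal :: "'r::comm_ring_1 set \<Rightarrow> bool" where
  "prime_ideal P \<longleftrightarrow>
     is_ideal P \<and> 1 \<notin> P \<and> (\<forall>a b. a * b \<in> P \<longrightarrow> a \<in> P \<or> b \<in> P)"

definition Spec :: "'r::comm_ring_1 set set" where
  "Spec = {P. prime_ideal P}"

definition radical :: "'r::comm_ring_1 set \<Rightarrow> 'r set" where
  "radical I = {f. \<exists>n. f ^ n \<in> I}"

definition ideal_mult :: "'r::comm_ring_1 set \<Rightarrow> 'r set \<Rightarrow> 'r set" where
  "ideal_mult I J = ideal_gen {x * y | x y. x \<in> I \<and> y \<in> J}"

fun ideal_power :: "'r::comm_ring_1 set \<Rightarrow> nat \<Rightarrow> 'r set" where
  "ideal_power I 0 = UNIV"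
| "ideal_power I (Suc n) = ideal_mult I (ideal_power I n)"


section \<open>Polynomials in an arbitrary set of variables\<close>

text \<open>Monomials are finitely supported exponent vectors, polynomials are finitely supported
  families of coefficients, so ('v, 'a) mpoly is A[x_v : v in 'v].\<close>

type_synonym ('v, 'a) mpoly = "('v \<Rightarrow>\<^sub>0 nat) \<Rightarrow>\<^sub>0 'a"

definition Var :: "'v \<Rightarrow> ('v, 'a::comm_ring_1) mpoly" where
  "Var v = Poly_Mapping.single (Poly_Mapping.single v 1) 1"

definition Const :: "'a::comm_ring_1 \<Rightarrow> ('v, 'a) mpoly" where
  "Const a = Poly_Mapping.single 0 a"

text \<open>When \<open>h\<close> is a ring homomorphism, \<open>poly_eval h x\<close> is the ring homomorphism
  restricting to \<open>h\<close> on coefficients and sending the variable \<open>v\<close> to \<open>x v\<close>.\<close>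

definition poly_eval ::
    "('a::comm_ring_1 \<Rightarrow> 'b::comm_ring_1) \<Rightarrow> ('v \<Rightarrow> 'b) \<Rightarrow> ('v, 'a) mpoly \<Rightarrow> 'b" where
  "poly_eval h x p =
     (\<Sum>m\<in>Poly_Mapping.keys p.
        h (Poly_Mapping.lookup p m) * (\<Prod>v\<in>Poly_Mapping.keys m. x v ^ Poly_Mapping.lookup m v))"


section \<open>The localization of $A[t_\alpha]$ at the differences $t_\alpha - t_\beta$\<close>

inductive_set diffs :: "('i, 'a::comm_ring_1) mpoly set" where
  diffs_one: "1 \<in> diffs"
| diffs_mult: "s \<in> diffs \<Longrightarrow> \<alpha> \<noteq> \<beta> \<Longrightarrow> (Var \<alpha> - Var \<beta>) * s \<in> diffs"

lemma diffs_times: "s \<in> diffs \<Longrightarrow> s' \<in> diffs \<Longrightarrow> s * s' \<in> diffs"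
proof (induction rule: diffs.induct)
  case diffs_one
  then show ?case by simp
next
  case (diffs_mult s \<alpha> \<beta>)
  then show ?case
    unfolding mult.assoc by (intro diffs.diffs_mult)
qed

lemma lookup_Var_mult:
  fixes p :: "('i, 'a::comm_ring_1) mpoly"
  shows "Poly_Mapping.lookup (Var \<alpha> * p) (Poly_Mapping.single \<alpha> 1 + m) = Poly_Mapping.lookup p m"
proof -
  have "Poly_Mapping.lookup (Var \<alpha> * p) (Poly_Mapping.single \<alpha> 1 + m) =
      (\<Sum>l. (\<Sum>q. Poly_Mapping.lookup p q when Poly_Mapping.single \<alpha> 1 + m = l + q)
        when l = Poly_Mapping.single \<alpha> 1)"
    unfolding lookup_mult Var_def lookup_single
    by (intro Sum_any.cong) (auto simp: when_def)
  also have "\<dots> = Poly_Mapping.lookup p m"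
    by simp
  finally show ?thesis .
qed

lemma lookup_Var_mult_neq_0:
  fixes p :: "('i, 'a::comm_ring_1) mpoly"
  assumes "Poly_Mapping.lookup (Var \<alpha> * p) k \<noteq> 0"
  obtains m where "k = Poly_Mapping.single \<alpha> 1 + m" "Poly_Mapping.lookup p m \<noteq> 0"
proof -
  have "Poly_Mapping.lookup (Var \<alpha> * p) k =
      (\<Sum>l. (\<Sum>q. Poly_Mapping.lookup p q when k = l + q) when l = Poly_Mapping.single \<alpha> 1)"
    unfolding lookup_mult Var_def lookup_single
    by (intro Sum_any.cong) (auto simp: when_def)
  also have "\<dots> = (\<Sum>q. Poly_Mapping.lookup p q when k = Poly_Mapping.single \<alpha> 1 + q)"
    by simp
  finally have "(\<Sum>q. Poly_Mapping.lookup p q when k = Poly_Mapping.single \<alpha> 1 + q) \<noteq> 0"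
    using assms by simp
  then obtain q where "(Poly_Mapping.lookup p q when k = Poly_Mapping.single \<alpha> 1 + q) \<noteq> 0"
    by (rule Sum_any.not_neutral_obtains_not_neutral)
  then show ?thesis
    using that by auto
qed

lemma Var_diff_regular:
  fixes p :: "('i, 'a::comm_ring_1) mpoly"
  assumes "\<alpha> \<noteq> \<beta>" and "(Var \<alpha> - Var \<beta>) * p = 0"
  shows "p = 0"
proof (rule ccontr)
  assume "p \<noteq> 0"
  let ?d = "\<lambda>m. Poly_Mapping.lookup m \<alpha>"
  have "Poly_Mapping.keys p \<noteq> {}" using \<open>p \<noteq> 0\<close> by simp
  then have "Max (?d ` Poly_Mapping.keys p) \<in> ?d ` Poly_Mapping.keys p"
    by (intro Max_in) simp_all
  then obtain m where m: "m \<in> Poly_Mapping.keys p" "?d m = Max (?d ` Poly_Mapping.keys p)"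
    by (metis imageE)
  have max: "?d k \<le> ?d m" if "k \<in> Poly_Mapping.keys p" for k
    using that m(2) by simp
  have "Var \<alpha> * p = Var \<beta> * p"
    using assms(2) by (simp add: algebra_simps)
  then have "Poly_Mapping.lookup (Var \<beta> * p) (Poly_Mapping.single \<alpha> 1 + m) \<noteq> 0"
    using m(1) lookup_Var_mult[of \<alpha> p m] by (simp add: in_keys_iff)
  then obtain k where k: "Poly_Mapping.single \<alpha> 1 + m = Poly_Mapping.single \<beta> 1 + k"
      "Poly_Mapping.lookup p k \<noteq> 0"
    by (rule lookup_Var_mult_neq_0)
  have "?d (Poly_Mapping.single \<alpha> 1 + m) = ?d (Poly_Mapping.single \<beta> 1 + k)"
    using k(1) by simp
  then have "?d k = ?d m + 1"
    using assms(1) by (simp add: lookup_add lookup_single)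
  with max[of k] k(2) show False
    by (simp add: in_keys_iff)
qed

lemma zero_notin_diffs: "0 \<notin> (diffs :: ('i, 'a::comm_ring_1) mpoly set)"
proof -
  have "s \<noteq> 0" if "s \<in> diffs" for s :: "('i, 'a) mpoly"
    using that
  proof induction
    case diffs_one
    then show ?case by simp
  next
    case (diffs_mult s \<alpha> \<beta>)
    then show ?case
      using Var_diff_regular[of \<alpha> \<beta> s] by blast
  qed
  then show ?thesis by blast
qed

definition locrel ::
    "('i, 'a::comm_ring_1) mpoly \<times> ('i, 'a) mpoly \<Rightarrow> ('i, 'a) mpoly \<times> ('i, 'a) mpoly \<Rightarrow> bool" where
  "locrel x y \<longleftrightarrow> snd x \<in> diffs \<and> snd y \<in> diffs \<and>
     (\<exists>u\<in>diffs. u * (fst x * snd y) = u * (fst y * snd x))"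

lemma locrelI:
  assumes "snd x \<in> diffs" "snd y \<in> diffs" "fst x * snd y = fst y * snd x"
  shows "locrel x y"
  unfolding locrel_def assms(3) using assms(1,2) diffs_one by blast

lemma locrel_refl_iff: "locrel x x \<longleftrightarrow> snd x \<in> diffs"
  using locrelI[of x x] by (auto simp only: locrel_def)

lemma locrel_witness:
  assumes "w \<in> diffs"
    and "w * (fst z * snd z') = w * (fst z' * snd z)"
    and "snd z \<in> diffs" "snd z' \<in> diffs"
  shows "locrel z z'"
  using assms unfolding locrel_def by blast

lemma locrel_diffs: "locrel x y \<Longrightarrow> snd x \<in> diffs" "locrel x y \<Longrightarrow> snd y \<in> diffs"
  unfolding locrel_def by blast+

lemma locrel_sym: "locrel x y \<Longrightarrow> locrel y x"
  unfolding locrel_def by (elim conjE bexE, intro conjI bexI, assumption+, erule sym)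

lemma part_equivp_locrel:
  "part_equivp (locrel :: ('i, 'a::comm_ring_1) mpoly \<times> ('i, 'a) mpoly \<Rightarrow> _)"
proof (rule part_equivpI)
  show "\<exists>x :: ('i, 'a) mpoly \<times> ('i, 'a) mpoly. locrel x x"
    by (rule exI[of _ "(0, 1)"]) (simp add: locrelI diffs_one)
  show "symp (locrel :: ('i, 'a) mpoly \<times> ('i, 'a) mpoly \<Rightarrow> _)"
    by (rule sympI) (rule locrel_sym)
  show "transp (locrel :: ('i, 'a) mpoly \<times> ('i, 'a) mpoly \<Rightarrow> _)"
  proof (rule transpI)
    fix x y z :: "('i, 'a) mpoly \<times> ('i, 'a) mpoly"
    assume xy: "locrel x y" and yz: "locrel y z"
    obtain u where u: "u \<in> diffs" "u * (fst x * snd y) = u * (fst y * snd x)"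
      using xy unfolding locrel_def by blast
    obtain v where v: "v \<in> diffs" "v * (fst y * snd z) = v * (fst z * snd y)"
      using yz unfolding locrel_def by blast
    have "u * v * snd y * (fst x * snd z) = (u * (fst x * snd y)) * (v * snd z)"
      by (simp only: mult_ac)
    also have "\<dots> = (u * (fst y * snd x)) * (v * snd z)"
      by (simp only: u(2))
    also have "\<dots> = (u * snd x) * (v * (fst y * snd z))"
      by (simp only: mult_ac)
    also have "\<dots> = (u * snd x) * (v * (fst z * snd y))"
      by (simp only: v(2))
    also have "\<dots> = u * v * snd y * (fst z * snd x)"
      by (simp only: mult_ac)
    finally show "locrel x z"
      by (rule locrel_witness[rotated])
        (intro diffs_times u(1) v(1) locrel_diffs[OF xy] locrel_diffs[OF yz])+
  qed
qed

quotient_type (overloaded) ('i, 'a) conf_ring =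
    "('i, 'a::comm_ring_1) mpoly \<times> ('i, 'a) mpoly" / partial: locrel
  by (rule part_equivp_locrel)

instantiation conf_ring :: (type, comm_ring_1) comm_ring_1
begin

lift_definition zero_conf_ring :: "('a, 'b) conf_ring" is "(0, 1)"
  by (simp add: locrelI diffs_one)

lift_definition one_conf_ring :: "('a, 'b) conf_ring" is "(1, 1)"
  by (simp add: locrelI diffs_one)

lift_definition plus_conf_ring ::
    "('a, 'b) conf_ring \<Rightarrow> ('a, 'b) conf_ring \<Rightarrow> ('a, 'b) conf_ring"
  is "\<lambda>x y. (fst x * snd y + fst y * snd x, snd x * snd y)"
proof -
  fix x x' y y' :: "('a, 'b::comm_ring_1) mpoly \<times> ('a, 'b) mpoly"
  assume x: "locrel x x'" and y: "locrel y y'"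
  obtain u where u: "u \<in> diffs" "u * (fst x * snd x') = u * (fst x' * snd x)"
    using x unfolding locrel_def by blast
  obtain v where v: "v \<in> diffs" "v * (fst y * snd y') = v * (fst y' * snd y)"
    using y unfolding locrel_def by blast
  have "u * v * ((fst x * snd y + fst y * snd x) * (snd x' * snd y')) =
      (u * (fst x * snd x')) * (v * snd y * snd y') + (v * (fst y * snd y')) * (u * snd x * snd x')"
    by (simp only: distrib_left distrib_right mult_ac)
  also have "\<dots> = u * v * ((fst x' * snd y' + fst y' * snd x') * (snd x * snd y))"
    by (simp only: u(2) v(2)) (simp only: distrib_left distrib_right mult_ac)
  finally show "locrel (fst x * snd y + fst y * snd x, snd x * snd y)
      (fst x' * snd y' + fst y' * snd x', snd x' * snd y')"
    by (intro locrel_witness[of "u * v"])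
      (simp_all only: fst_conv snd_conv diffs_times u(1) v(1) locrel_diffs[OF x] locrel_diffs[OF y])
qed

lift_definition uminus_conf_ring :: "('a, 'b) conf_ring \<Rightarrow> ('a, 'b) conf_ring"
  is "\<lambda>x. (- fst x, snd x)"
  by (simp add: locrel_def)

definition minus_conf_ring ::
    "('a, 'b) conf_ring \<Rightarrow> ('a, 'b) conf_ring \<Rightarrow> ('a, 'b) conf_ring" where
  "minus_conf_ring x y = x + - y"

lift_definition times_conf_ring ::
    "('a, 'b) conf_ring \<Rightarrow> ('a, 'b) conf_ring \<Rightarrow> ('a, 'b) conf_ring"
  is "\<lambda>x y. (fst x * fst y, snd x * snd y)"
proof -
  fix x x' y y' :: "('a, 'b::comm_ring_1) mpoly \<times> ('a, 'b) mpoly"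
  assume x: "locrel x x'" and y: "locrel y y'"
  obtain u where u: "u \<in> diffs" "u * (fst x * snd x') = u * (fst x' * snd x)"
    using x unfolding locrel_def by blast
  obtain v where v: "v \<in> diffs" "v * (fst y * snd y') = v * (fst y' * snd y)"
    using y unfolding locrel_def by blast
  have "u * v * (fst x * fst y * (snd x' * snd y')) =
      (u * (fst x * snd x')) * (v * (fst y * snd y'))"
    by (simp only: mult_ac)
  also have "\<dots> = u * v * (fst x' * fst y' * (snd x * snd y))"
    by (simp only: u(2) v(2)) (simp only: mult_ac)
  finally show "locrel (fst x * fst y, snd x * snd y) (fst x' * fst y', snd x' * snd y')"
    by (intro locrel_witness[of "u * v"])
      (simp_all only: fst_conv snd_conv diffs_times u(1) v(1) locrel_diffs[OF x] locrel_diffs[OF y])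
qed

instance
proof
  fix a b c :: "('a, 'b::comm_ring_1) conf_ring"
  show "a + b + c = a + (b + c)"
    by transfer (rule locrelI; simp only: locrel_refl_iff diffs_times diffs_one fst_conv snd_conv
        distrib_left distrib_right mult_ac add_ac mult_zero_left mult_zero_right mult_1_left mult_1_right
        add_0_left add_0_right mult_minus_left mult_minus_right left_minus right_minus)
  show "a + b = b + a"
    by transfer (rule locrelI; simp only: locrel_refl_iff diffs_times diffs_one fst_conv snd_conv
        distrib_left distrib_right mult_ac add_ac mult_zero_left mult_zero_right mult_1_left mult_1_right
        add_0_left add_0_right mult_minus_left mult_minus_right left_minus right_minus)
  show "0 + a = a"
    by transfer (rule locrelI; simp only: locrel_refl_iff diffs_times diffs_one fst_conv snd_conv
        distrib_left distrib_right mult_ac add_ac mult_zero_left mult_zero_right mult_1_left mult_1_right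
        add_0_left add_0_right mult_minus_left mult_minus_right left_minus right_minus)
  show "- a + a = 0"
    by transfer (rule locrelI; simp only: locrel_refl_iff diffs_times diffs_one fst_conv snd_conv
        distrib_left distrib_right mult_ac add_ac mult_zero_left mult_zero_right mult_1_left mult_1_right
        add_0_left add_0_right mult_minus_left mult_minus_right left_minus right_minus)
  show "a - b = a + - b"
    by (rule minus_conf_ring_def)
  show "a * b * c = a * (b * c)"
    by transfer (rule locrelI; simp only: locrel_refl_iff diffs_times diffs_one fst_conv snd_conv
        distrib_left distrib_right mult_ac add_ac mult_zero_left mult_zero_right mult_1_left mult_1_right
        add_0_left add_0_right mult_minus_left mult_minus_right left_minus right_minus)
  show "a * b = b * a"
    by transfer (rule locrelI; simp only: locrel_refl_iff diffs_times diffs_one fst_conv snd_conv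
        distrib_left distrib_right mult_ac add_ac mult_zero_left mult_zero_right mult_1_left mult_1_right
        add_0_left add_0_right mult_minus_left mult_minus_right left_minus right_minus)
  show "1 * a = a"
    by transfer (rule locrelI; simp only: locrel_refl_iff diffs_times diffs_one fst_conv snd_conv
        distrib_left distrib_right mult_ac add_ac mult_zero_left mult_zero_right mult_1_left mult_1_right
        add_0_left add_0_right mult_minus_left mult_minus_right left_minus right_minus)
  show "(a + b) * c = a * c + b * c"
    by transfer (rule locrelI; simp only: locrel_refl_iff diffs_times diffs_one fst_conv snd_conv
        distrib_left distrib_right mult_ac add_ac mult_zero_left mult_zero_right mult_1_left mult_1_right
        add_0_left add_0_right mult_minus_left mult_minus_right left_minus right_minus)
  show "(0 :: ('a, 'b) conf_ring) \<noteq> 1"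
    by transfer (simp add: locrel_def zero_notin_diffs)
qed

end

text \<open>The localization map $A[t_\alpha] \to A[t_\alpha][(t_\alpha-t_\beta)^{-1}]$.\<close>

definition conf_of_poly :: "('i, 'a::comm_ring_1) mpoly \<Rightarrow> ('i, 'a) conf_ring" where
  "conf_of_poly p = abs_conf_ring (p, 1)"

lemma abs_conf_ring_eq_iff:
  assumes "s \<in> diffs" "s' \<in> diffs"
  shows "abs_conf_ring (a, s) = abs_conf_ring (b, s') \<longleftrightarrow> (\<exists>u\<in>diffs. u * (a * s') = u * (b * s))"
proof -
  have "locrel (a, s) (a, s)" "locrel (b, s') (b, s')"
    using assms by (simp_all only: locrel_refl_iff snd_conv)
  then have "abs_conf_ring (a, s) = abs_conf_ring (b, s') \<longleftrightarrow> locrel (a, s) (b, s')"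
    using Quotient_rel[OF Quotient_conf_ring, of "(a, s)" "(b, s')"] by blast
  with assms show ?thesis
    by (simp only: locrel_def fst_conv snd_conv simp_thms)
qed

lemma conf_of_poly_simps:
  "conf_of_poly 0 = 0" "conf_of_poly 1 = 1"
  "conf_of_poly (p + q) = conf_of_poly p + conf_of_poly q"
  "conf_of_poly (p * q) = conf_of_poly p * conf_of_poly q"
  by (simp_all add: conf_of_poly_def zero_conf_ring_def one_conf_ring_def
      plus_conf_ring.abs_eq times_conf_ring.abs_eq locrelI diffs_one)

lemma conf_of_poly_eq_iff:
  "conf_of_poly p = conf_of_poly q \<longleftrightarrow> (\<exists>u\<in>diffs. u * p = u * q)"
  by (simp add: conf_of_poly_def abs_conf_ring_eq_iff diffs_one)

lemma conf_of_poly_unit: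
  assumes "s \<in> diffs"
  shows "conf_of_poly s dvd 1"
proof -
  have "conf_of_poly s * abs_conf_ring (1, s) = 1"
    using assms by (simp add: conf_of_poly_def one_conf_ring_def times_conf_ring.abs_eq locrelI
        diffs_one abs_conf_ring_eq_iff) (use diffs_one in blast)
  then show ?thesis by (metis dvd_triv_left)
qed

lemma conf_ring_fraction:
  obtains p s where "s \<in> diffs" "conf_of_poly s * x = conf_of_poly p"
proof -
  obtain a s where as: "x = abs_conf_ring (a, s)" "s \<in> diffs"
    by (metis Quotient_abs_rep[OF Quotient_conf_ring] Quotient_rep_reflp[OF Quotient_conf_ring]
        locrel_def prod.collapse)
  have "conf_of_poly s * x = conf_of_poly a"
    using as by (simp add: conf_of_poly_def times_conf_ring.abs_eq locrelI
        diffs_one abs_conf_ring_eq_iff) (metis diffs_one mult.commute)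
  with as(2) that show ?thesis by blast
qed


section \<open>Compositions, weightings and partitions\<close>

text \<open>The finite index set is the finite type 'i. The set of positive integers indexing the
  variables $\xi_i$ and $\epsilon_i$ is replaced by the type of natural numbers, which only
  shifts the labels by one.\<close>

definition inf_composition :: "('i::finite \<Rightarrow> enat) \<Rightarrow> bool" where
  "inf_composition lam \<longleftrightarrow> (\<forall>\<alpha>. 1 \<le> lam \<alpha>) \<and> (\<exists>\<alpha>. lam \<alpha> = \<infinity>)"

definition weighting :: "('i::finite \<Rightarrow> nat) \<Rightarrow> bool" where
  "weighting e \<longleftrightarrow> (\<forall>\<alpha>. 1 \<le> e \<alpha>)"

definition red :: "('i::finite \<Rightarrow> enat) \<Rightarrow> ('i \<Rightarrow> nat) \<Rightarrow> 'i \<Rightarrow> nat" where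
  "red lam e \<alpha> = (if lam \<alpha> = \<infinity> then e \<alpha> else 1)"

definition ecard :: "'b set \<Rightarrow> enat" where
  "ecard S = (if finite S then enat (card S) else \<infinity>)"

definition partition_of_type :: "('i::finite \<Rightarrow> enat) \<Rightarrow> ('i \<Rightarrow> nat set) \<Rightarrow> bool" where
  "partition_of_type lam U \<longleftrightarrow>
     disjoint_family U \<and> (\<forall>\<alpha>. U \<alpha> \<noteq> {}) \<and> (\<Union>\<alpha>. U \<alpha>) = UNIV \<and> (\<forall>\<alpha>. ecard (U \<alpha>) = lam \<alpha>)"

definition block_of :: "('i::finite \<Rightarrow> nat set) \<Rightarrow> nat \<Rightarrow> 'i" where
  "block_of U i = (THE \<alpha>. i \<in> U \<alpha>)"


section \<open>The symmetric group action and $\mathfrak{S}$-ideals\<close>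

text \<open>The type nat perm consists of the permutations moving only finitely many elements.\<close>

definition perm_act :: "nat perm \<Rightarrow> (nat, 'a::comm_ring_1) mpoly \<Rightarrow> (nat, 'a) mpoly" where
  "perm_act \<sigma> = poly_eval Const (\<lambda>i. Var (\<sigma> \<langle>$\<rangle> i))"

definition S_ideal :: "(nat, 'a::comm_ring_1) mpoly set \<Rightarrow> bool" where
  "S_ideal I \<longleftrightarrow> is_ideal I \<and> (\<forall>\<sigma>. \<forall>f\<in>I. perm_act \<sigma> f \<in> I)"

definition S_radical :: "(nat, 'a::comm_ring_1) mpoly set \<Rightarrow> (nat, 'a) mpoly set" where
  "S_radical I = ideal_gen (\<Union>{J. S_ideal J \<and> (\<exists>n. ideal_power J n \<subseteq> I)})"


section \<open>The ideals $\mathfrak{P}(\lambda,e;Z)$\<close>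

definition conf_var :: "'i \<Rightarrow> ('i, 'a::comm_ring_1) conf_ring" where
  "conf_var \<alpha> = conf_of_poly (Var \<alpha>)"

text \<open>\<open>('i, 'a) conf_eps_ring\<close> is the polynomial ring over the localization in the variables
  $\epsilon_i$, which are \<open>Var i\<close>.\<close>

type_synonym ('i, 'a) conf_eps_ring = "(nat, ('i, 'a) conf_ring) mpoly"

text \<open>For empty \<open>Z\<close> the intersection is the unit ideal.\<close>

definition ideal_of_pts :: "'r::comm_ring_1 set set \<Rightarrow> 'r set" where
  "ideal_of_pts Z = \<Inter>Z"

definition frakQ ::
    "('i::finite \<Rightarrow> nat set) \<Rightarrow> ('i \<Rightarrow> nat) \<Rightarrow> ('i, 'a::comm_ring_1) conf_ring set set
      \<Rightarrow> ('i, 'a) conf_eps_ring set" where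
  "frakQ U e Z = ideal_gen (Const ` ideal_of_pts Z \<union> {Var i ^ e (block_of U i) | i. True})"

definition iota ::
    "('i::finite \<Rightarrow> nat set) \<Rightarrow> (nat, 'a::comm_ring_1) mpoly \<Rightarrow> ('i, 'a) conf_eps_ring" where
  "iota U = poly_eval (\<lambda>a. Const (conf_of_poly (Const a)))
                      (\<lambda>i. Const (conf_var (block_of U i)) + Var i)"

text \<open>The composition $\lambda$ enters only as the type of the partition \<open>U\<close>.\<close>

definition frakP ::
    "('i::finite \<Rightarrow> nat set) \<Rightarrow> ('i \<Rightarrow> nat) \<Rightarrow> ('i, 'a::comm_ring_1) conf_ring set set
      \<Rightarrow> (nat, 'a) mpoly set" where
  "frakP U e Z = {f. \<forall>\<sigma>. iota U (perm_act \<sigma> f) \<in> frakQ U e Z}"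

end

theory Submission
  imports Defs
begin

text \<open>
  Write \<open>I\<close> for the radical ideal of \<open>Z\<close> and call a monomial in the \<open>\<epsilon>\<^sub>i\<close> \<^emph>\<open>small\<close> if every \<open>\<epsilon>\<^sub>i\<close>
  occurs with exponent less than its weight. Since $\mathfrak{Q}$ is generated by \<open>I\<close> and by powers
  of variables, it consists of the polynomials whose coefficients at all small monomials lie in
  \<open>I\<close> (\<open>ideal_gen_eq_coeffs_in\<close>). All three parts are read off from this description. Part (c) is
  then immediate, because the ideal of a union of sets of points is an intersection.

  Two inclusions are nilpotency statements with the same proof. Let \<open>F\<close> be a finite set of indices,
  and let \<open>T\<^sub>k\<close> be the ideal of polynomials whose coefficients lie in \<open>I\<close> at the small monomials of
  degree less than \<open>k\<close> in the \<open>\<epsilon>\<^sub>i\<close> with \<open>i\<close> in \<open>F\<close>. Then \<open>T\<^sub>1 T\<^sub>k\<close> is contained in \<open>T\<^bsub>k+1\<^esub>\<close>, and \<open>T\<^sub>k\<close>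
  equals $\mathfrak{Q}$ once \<open>k\<close> exceeds the sum of the weights over \<open>F\<close>, as smallness bounds the
  degree. For an \<open>f\<close> in $\mathfrak{P}(\lambda;Z)$ take for \<open>F\<close> the variables of \<open>\<sigma> f\<close>; their number
  does not depend on \<open>\<sigma>\<close>, so that one power of \<open>f\<close> works for all \<open>\<sigma>\<close>. For the $\mathfrak{S}$-radical take
  for \<open>F\<close> the union of the finite blocks, where the reduced weights are 1.

  Conversely, the constant coefficient of a power is the power of the constant coefficient, which
  gives the other half of (a) because \<open>I\<close> is a radical ideal. The other half of (b) is the heart of
  the matter. Let \<open>J\<close> be an $\mathfrak{S}$-ideal containing an \<open>f\<close> whose image has a coefficient outside some
  prime \<open>P\<close> in \<open>Z\<close> at a monomial that is small for the reduced weights; such a monomial involves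
  only indices in infinite blocks. As these blocks have room, a block-preserving permutation moves
  the variables of \<open>f\<close> in infinite blocks away from any given finite set
  (\<open>block_preserving_perm_exists\<close>). Multiplying \<open>k\<close> such translates of \<open>f\<close> gives an element of
  \<open>J\<^sup>k\<close> with a coefficient at a small monomial that is a product of elements outside \<open>P\<close>
  (\<open>ideal_power_lookup_notin_prime\<close>), so that no power of \<open>J\<close> is contained in
  $\mathfrak{P}(\lambda,e;Z)$.
\<close>


section \<open>Ideals\<close>

lemma is_ideal_iff:
  "is_ideal I \<longleftrightarrow> 0 \<in> I \<and> (\<forall>x\<in>I. \<forall>y\<in>I. x + y \<in> I) \<and> (\<forall>c. \<forall>x\<in>I. c * x \<in> I)"
  by (simp add: module.subspace_def[OF module_times])

lemma
  assumes "is_ideal I"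
  shows is_ideal_zero: "0 \<in> I"
    and is_ideal_add: "x \<in> I \<Longrightarrow> y \<in> I \<Longrightarrow> x + y \<in> I"
    and is_ideal_mult_left: "x \<in> I \<Longrightarrow> c * x \<in> I"
    and is_ideal_mult_right: "x \<in> I \<Longrightarrow> x * c \<in> I"
  using assms by (auto simp: is_ideal_iff mult.commute)

lemma is_ideal_sum: "is_ideal I \<Longrightarrow> (\<And>x. x \<in> A \<Longrightarrow> f x \<in> I) \<Longrightarrow> sum f A \<in> I"
  by (rule module.subspace_sum[OF module_times])

lemma is_ideal_ideal_gen: "is_ideal (ideal_gen S)"
  by (rule module.subspace_span[OF module_times])

lemma ideal_gen_base: "x \<in> S \<Longrightarrow> x \<in> ideal_gen S"
  by (rule module.span_base[OF module_times])

lemma ideal_gen_subset: "S \<subseteq> I \<Longrightarrow> is_ideal I \<Longrightarrow> ideal_gen S \<subseteq> I"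
  by (rule module.span_minimal[OF module_times])

lemma is_ideal_ideal_of_pts: "Z \<subseteq> Spec \<Longrightarrow> is_ideal (ideal_of_pts Z)"
  unfolding ideal_of_pts_def
  by (rule module.subspace_Inter[OF module_times]) (auto simp: Spec_def prime_ideal_def)

lemma prime_ideal_power: "prime_ideal P \<Longrightarrow> x ^ n \<in> P \<Longrightarrow> x \<in> P"
  by (induction n) (auto simp: prime_ideal_def)

lemma ideal_of_pts_power: "Z \<subseteq> Spec \<Longrightarrow> x ^ n \<in> ideal_of_pts Z \<Longrightarrow> x \<in> ideal_of_pts Z"
  unfolding ideal_of_pts_def Spec_def by (blast intro: prime_ideal_power)


section \<open>Polynomials and their coefficients\<close>

lemma sum_single_keys:
  fixes p :: "'k \<Rightarrow>\<^sub>0 'b::comm_monoid_add"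
  shows "(\<Sum>m\<in>Poly_Mapping.keys p. Poly_Mapping.single m (Poly_Mapping.lookup p m)) = p"
  by (rule poly_mapping_eqI)
    (auto simp: lookup_sum lookup_single when_def in_keys_iff sum.delta')

lemma poly_mapping_single_induct [case_names single add]:
  fixes p :: "'k \<Rightarrow>\<^sub>0 'b::comm_monoid_add"
  assumes "\<And>m c. P (Poly_Mapping.single m c)" and "\<And>p q. P p \<Longrightarrow> P q \<Longrightarrow> P (p + q)"
  shows "P p"
proof -
  have "P (\<Sum>m\<in>A. Poly_Mapping.single m (Poly_Mapping.lookup p m))" if "finite A" for A
    using that
  proof (induction A)
    case empty
    show ?case using assms(1)[of undefined 0] by simp
  qed (simp add: assms)
  from this[of "Poly_Mapping.keys p"] show ?thesis by (simp add: sum_single_keys)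
qed

lemma lookup_times_sum:
  fixes f g :: "('v, 'a::comm_ring_1) mpoly"
  shows "Poly_Mapping.lookup (f * g) k =
    (\<Sum>a\<in>Poly_Mapping.keys f. \<Sum>b\<in>Poly_Mapping.keys g.
      Poly_Mapping.lookup f a * Poly_Mapping.lookup g b when a + b = k)"
proof -
  have "f * g = (\<Sum>a\<in>Poly_Mapping.keys f. Poly_Mapping.single a (Poly_Mapping.lookup f a)) *
      (\<Sum>b\<in>Poly_Mapping.keys g. Poly_Mapping.single b (Poly_Mapping.lookup g b))"
    by (simp only: sum_single_keys)
  also have "\<dots> = (\<Sum>a\<in>Poly_Mapping.keys f. \<Sum>b\<in>Poly_Mapping.keys g.
      Poly_Mapping.single (a + b) (Poly_Mapping.lookup f a * Poly_Mapping.lookup g b))"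
    by (simp add: sum_product mult_single)
  finally have "f * g = \<dots>" .
  then show ?thesis
    by (simp add: lookup_sum lookup_single)
qed

text \<open>If only one pair of monomials of \<open>p\<close> and \<open>q\<close> contributes to a coefficient of the product,
  no cancellation can occur there.\<close>

lemma lookup_times_unique:
  fixes p q :: "('v, 'a::comm_ring_1) mpoly"
  assumes "\<And>a b. a + b = m + n \<Longrightarrow> Poly_Mapping.lookup p a \<noteq> 0 \<Longrightarrow> Poly_Mapping.lookup q b \<noteq> 0 \<Longrightarrow>
    a = m \<and> b = n"
  shows "Poly_Mapping.lookup (p * q) (m + n) = Poly_Mapping.lookup p m * Poly_Mapping.lookup q n"
proof -
  have "Poly_Mapping.lookup (p * q) (m + n) = (\<Sum>a\<in>Poly_Mapping.keys p. \<Sum>b\<in>Poly_Mapping.keys q.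
      (if a = m then Poly_Mapping.lookup p a else 0) * (if b = n then Poly_Mapping.lookup q b else 0))"
    unfolding lookup_times_sum
    using assms by (intro sum.cong) (auto simp: when_def in_keys_iff)
  also have "\<dots> = Poly_Mapping.lookup p m * Poly_Mapping.lookup q n"
    by (simp add: sum_product[symmetric] sum.delta in_keys_iff)
  finally show ?thesis .
qed

lemma lookup_times_zero:
  fixes p q :: "('v, 'a::comm_ring_1) mpoly"
  shows "Poly_Mapping.lookup (p * q) 0 = Poly_Mapping.lookup p 0 * Poly_Mapping.lookup q 0"
proof -
  have "Poly_Mapping.lookup (p * q) (0 + 0) = Poly_Mapping.lookup p 0 * Poly_Mapping.lookup q 0"
    by (rule lookup_times_unique) (auto simp: poly_mapping_eq_iff lookup_add fun_eq_iff)
  then show ?thesis by simp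
qed

lemma lookup_power_zero:
  fixes f :: "('v, 'a::comm_ring_1) mpoly"
  shows "Poly_Mapping.lookup (f ^ n) 0 = Poly_Mapping.lookup f 0 ^ n"
  by (induction n) (simp_all add: lookup_times_zero)

lemma Var_power: "Var v ^ k = Poly_Mapping.single (Poly_Mapping.single v k) 1"
  by (induction k) (simp_all add: Var_def mult_single flip: single_add)

lemma Const_simps:
  "Const 0 = 0" "Const 1 = 1" "Const (a + b) = Const a + Const b" "Const (a * b) = Const a * Const b"
  by (simp_all add: Const_def single_add mult_single)


text \<open>The variables that occur in a polynomial.\<close>

definition vars :: "('v, 'a::comm_ring_1) mpoly \<Rightarrow> 'v set" where
  "vars p = (\<Union>m\<in>Poly_Mapping.keys p. Poly_Mapping.keys m)"

lemma finite_vars: "finite (vars p)"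
  by (simp add: vars_def)

lemma vars_subset_iff:
  "vars p \<subseteq> V \<longleftrightarrow> (\<forall>m. Poly_Mapping.lookup p m \<noteq> 0 \<longrightarrow> Poly_Mapping.keys m \<subseteq> V)"
  by (simp only: vars_def UN_subset_iff Ball_def in_keys_iff)

lemma vars_Const: "vars (Const c) = {}"
  by (simp add: vars_def Const_def)

lemma vars_Var: "vars (Var v :: ('v, 'a::comm_ring_1) mpoly) = {v}"
  by (simp add: vars_def Var_def)

lemma vars_add: "vars (p + q) \<subseteq> vars p \<union> vars q"
  using keys_add[of p q] by (auto simp: vars_def)

lemma vars_mult: "vars (p * q) \<subseteq> vars p \<union> vars q"
proof
  fix v assume "v \<in> vars (p * q)"
  then obtain m where m: "m \<in> Poly_Mapping.keys (p * q)" "v \<in> Poly_Mapping.keys m"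
    by (auto simp: vars_def)
  from m(1) obtain a b where "m = a + b" "a \<in> Poly_Mapping.keys p" "b \<in> Poly_Mapping.keys q"
    using keys_mult[of p q] by blast
  with m(2) show "v \<in> vars p \<union> vars q"
    by (auto simp: vars_def in_keys_iff lookup_add)
qed

lemma vars_sum_subset: "(\<And>x. x \<in> A \<Longrightarrow> vars (f x) \<subseteq> V) \<Longrightarrow> vars (sum f A) \<subseteq> V"
proof (induction A rule: infinite_finite_induct)
  case (insert x A)
  then show ?case using vars_add[of "f x" "sum f A"] by auto
qed (simp_all add: vars_def)

lemma vars_prod_subset: "(\<And>x. x \<in> A \<Longrightarrow> vars (f x) \<subseteq> V) \<Longrightarrow> vars (prod f A) \<subseteq> V"
proof (induction A rule: infinite_finite_induct)
  case (insert x A)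
  then show ?case using vars_mult[of "f x" "prod f A"] by auto
qed (simp_all add: vars_def)

lemma vars_power_subset: "vars (p ^ n) \<subseteq> vars p"
proof (induction n)
  case (Suc n)
  then show ?case using vars_mult[of p "p ^ n"] by auto
qed (simp add: vars_def)

lemma vars_poly_eval_subset:
  assumes "\<And>c. vars (h c) \<subseteq> V" and "\<And>v. v \<in> vars p \<Longrightarrow> vars (x v) \<subseteq> V"
  shows "vars (poly_eval h x p) \<subseteq> V"
  unfolding poly_eval_def
proof (rule vars_sum_subset)
  fix m assume m: "m \<in> Poly_Mapping.keys p"
  have "vars (x v ^ Poly_Mapping.lookup m v) \<subseteq> V" if "v \<in> Poly_Mapping.keys m" for v
  proof -
    have "v \<in> vars p" using that m by (auto simp: vars_def)
    then show ?thesis using order_trans[OF vars_power_subset assms(2)] by blast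
  qed
  then have "vars (\<Prod>v\<in>Poly_Mapping.keys m. x v ^ Poly_Mapping.lookup m v) \<subseteq> V"
    by (rule vars_prod_subset)
  then show "vars (h (Poly_Mapping.lookup p m) *
      (\<Prod>v\<in>Poly_Mapping.keys m. x v ^ Poly_Mapping.lookup m v)) \<subseteq> V"
    by (intro order_trans[OF vars_mult] Un_least assms(1))
qed


section \<open>Evaluation homomorphisms\<close>

text \<open>Unital homomorphisms of commutative rings.\<close>

definition ring_hom :: "('r::comm_ring_1 \<Rightarrow> 's::comm_ring_1) \<Rightarrow> bool" where
  "ring_hom \<phi> \<longleftrightarrow> \<phi> 1 = 1 \<and> (\<forall>a b. \<phi> (a + b) = \<phi> a + \<phi> b) \<and> (\<forall>a b. \<phi> (a * b) = \<phi> a * \<phi> b)"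

lemma
  assumes "ring_hom \<phi>"
  shows ring_hom_one: "\<phi> 1 = 1"
    and ring_hom_add: "\<phi> (a + b) = \<phi> a + \<phi> b"
    and ring_hom_mult: "\<phi> (a * b) = \<phi> a * \<phi> b"
    and ring_hom_zero: "\<phi> 0 = 0"
proof -
  show "\<phi> 1 = 1" "\<phi> (a + b) = \<phi> a + \<phi> b" "\<phi> (a * b) = \<phi> a * \<phi> b"
    using assms by (simp_all add: ring_hom_def)
  have "\<phi> (0 + 0) = \<phi> 0 + \<phi> 0"
    using assms unfolding ring_hom_def by blast
  then show "\<phi> 0 = 0" by simp
qed

lemma ring_hom_power: "ring_hom \<phi> \<Longrightarrow> \<phi> (a ^ n) = \<phi> a ^ n"
  by (induction n) (simp_all add: ring_hom_one ring_hom_mult)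

lemma ring_hom_sum: "ring_hom \<phi> \<Longrightarrow> \<phi> (sum f A) = (\<Sum>x\<in>A. \<phi> (f x))"
  by (induction A rule: infinite_finite_induct) (simp_all add: ring_hom_zero ring_hom_add)

lemma ring_hom_prod: "ring_hom \<phi> \<Longrightarrow> \<phi> (prod f A) = (\<Prod>x\<in>A. \<phi> (f x))"
  by (induction A rule: infinite_finite_induct) (simp_all add: ring_hom_one ring_hom_mult)

lemma ring_hom_compose: "ring_hom \<phi> \<Longrightarrow> ring_hom \<psi> \<Longrightarrow> ring_hom (\<lambda>a. \<phi> (\<psi> a))"
  by (simp add: ring_hom_def)

lemma ring_hom_Const: "ring_hom Const"
  by (simp add: ring_hom_def Const_simps)

lemma ring_hom_conf_of_poly: "ring_hom conf_of_poly"
  by (simp add: ring_hom_def conf_of_poly_simps)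

lemma poly_eval_superset:
  assumes "ring_hom h" "finite S" "Poly_Mapping.keys p \<subseteq> S"
  shows "poly_eval h x p = (\<Sum>m\<in>S. h (Poly_Mapping.lookup p m) *
    (\<Prod>v\<in>Poly_Mapping.keys m. x v ^ Poly_Mapping.lookup m v))"
  unfolding poly_eval_def using assms
  by (intro sum.mono_neutral_left) (auto simp: in_keys_iff ring_hom_zero)

lemma prod_keys_superset:
  fixes x :: "'v \<Rightarrow> 'a::comm_ring_1"
  assumes "finite S" "Poly_Mapping.keys m \<subseteq> S"
  shows "(\<Prod>v\<in>Poly_Mapping.keys m. x v ^ Poly_Mapping.lookup m v) =
    (\<Prod>v\<in>S. x v ^ Poly_Mapping.lookup m v)"
  using assms by (intro prod.mono_neutral_left) (auto simp: in_keys_iff)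

lemma prod_keys_add:
  fixes x :: "'v \<Rightarrow> 'a::comm_ring_1"
  shows "(\<Prod>v\<in>Poly_Mapping.keys (m + n). x v ^ Poly_Mapping.lookup (m + n) v) =
    (\<Prod>v\<in>Poly_Mapping.keys m. x v ^ Poly_Mapping.lookup m v) *
    (\<Prod>v\<in>Poly_Mapping.keys n. x v ^ Poly_Mapping.lookup n v)"
proof -
  let ?S = "Poly_Mapping.keys m \<union> Poly_Mapping.keys n"
  have "Poly_Mapping.keys (m + n) \<subseteq> ?S" by (rule keys_add)
  then have "(\<Prod>v\<in>Poly_Mapping.keys (m + n). x v ^ Poly_Mapping.lookup (m + n) v) =
      (\<Prod>v\<in>?S. x v ^ Poly_Mapping.lookup (m + n) v)"
    by (intro prod_keys_superset) simp_all
  also have "\<dots> = (\<Prod>v\<in>?S. x v ^ Poly_Mapping.lookup m v) *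
      (\<Prod>v\<in>?S. x v ^ Poly_Mapping.lookup n v)"
    by (simp add: lookup_add power_add prod.distrib)
  finally show ?thesis
    by (simp add: prod_keys_superset[of ?S])
qed

lemma poly_eval_single:
  assumes "ring_hom h"
  shows "poly_eval h x (Poly_Mapping.single m c) =
    h c * (\<Prod>v\<in>Poly_Mapping.keys m. x v ^ Poly_Mapping.lookup m v)"
  using assms by (simp add: poly_eval_superset[of h "{m}"])

lemma poly_eval_add:
  assumes "ring_hom h"
  shows "poly_eval h x (p + q) = poly_eval h x p + poly_eval h x q"
proof -
  let ?S = "Poly_Mapping.keys p \<union> Poly_Mapping.keys q"
  have "Poly_Mapping.keys (p + q) \<subseteq> ?S" by (rule keys_add)
  then show ?thesis
    using assms
    by (simp add: poly_eval_superset[of h ?S] lookup_add ring_hom_add distrib_right sum.distrib)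
qed

lemma poly_eval_mult:
  assumes "ring_hom h"
  shows "poly_eval h x (p * q) = poly_eval h x p * poly_eval h x q"
proof (induction p rule: poly_mapping_single_induct)
  case (single m c)
  show ?case
  proof (induction q rule: poly_mapping_single_induct)
    case (single n d)
    show ?case
      using assms
      by (simp add: mult_single poly_eval_single prod_keys_add ring_hom_mult mult_ac)
  next
    case (add q q')
    then show ?case using assms by (simp add: poly_eval_add distrib_left)
  qed
next
  case (add p p')
  then show ?case using assms by (simp add: poly_eval_add distrib_right)
qed

lemma poly_eval_Const: "ring_hom h \<Longrightarrow> poly_eval h x (Const c) = h c"
  by (simp add: Const_def poly_eval_single)

lemma poly_eval_Var: "ring_hom h \<Longrightarrow> poly_eval h x (Var v) = x v"
  by (simp add: Var_def poly_eval_single ring_hom_one)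

lemma ring_hom_poly_eval: "ring_hom h \<Longrightarrow> ring_hom (poly_eval h x)"
  using poly_eval_Const[of h x 1]
  by (simp add: ring_hom_def[of "poly_eval h x"] poly_eval_add poly_eval_mult Const_simps ring_hom_one)

lemma ring_hom_of_poly_eval:
  assumes "ring_hom \<phi>"
  shows "\<phi> (poly_eval h x p) = poly_eval (\<lambda>c. \<phi> (h c)) (\<lambda>v. \<phi> (x v)) p"
  using assms by (simp add: poly_eval_def ring_hom_sum ring_hom_prod ring_hom_mult ring_hom_power)

lemma ring_hom_perm_act: "ring_hom (perm_act \<sigma>)"
  unfolding perm_act_def by (intro ring_hom_poly_eval ring_hom_Const)

lemma ring_hom_iota_coeff: "ring_hom (\<lambda>a. Const (conf_of_poly (Const a)))"
  by (rule ring_hom_compose[OF ring_hom_Const ring_hom_compose[OF ring_hom_conf_of_poly ring_hom_Const]])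

lemma ring_hom_iota: "ring_hom (iota U)"
  unfolding iota_def by (intro ring_hom_poly_eval ring_hom_iota_coeff)

lemma perm_act_Const: "perm_act \<sigma> (Const c) = Const c"
  by (simp add: perm_act_def poly_eval_Const ring_hom_Const)

lemma perm_act_Var: "perm_act \<sigma> (Var i) = Var (\<sigma> \<langle>$\<rangle> i)"
  by (simp add: perm_act_def poly_eval_Var ring_hom_Const)

lemma iota_Const: "iota U (Const c) = Const (conf_of_poly (Const c))"
  by (simp add: iota_def poly_eval_Const[OF ring_hom_iota_coeff])

lemma iota_Var: "iota U (Var i) = Const (conf_var (block_of U i)) + Var i"
  by (simp add: iota_def poly_eval_Var[OF ring_hom_iota_coeff])

lemma perm_act_perm_act: "perm_act \<sigma> (perm_act \<tau> f) = perm_act (\<sigma> * \<tau>) f"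
proof -
  have "perm_act \<sigma> (perm_act \<tau> f) =
      poly_eval (\<lambda>c. perm_act \<sigma> (Const c)) (\<lambda>i. perm_act \<sigma> (Var (\<tau> \<langle>$\<rangle> i))) f"
    unfolding perm_act_def[of \<tau>] by (rule ring_hom_of_poly_eval[OF ring_hom_perm_act])
  also have "\<dots> = perm_act (\<sigma> * \<tau>) f"
    by (simp add: perm_act_Const perm_act_Var perm_act_def[of "\<sigma> * \<tau>"] apply_times)
  finally show ?thesis .
qed

text \<open>The embedding \<open>iota\<close> is equivariant for the permutations that preserve every block.\<close>

lemma iota_perm_act:
  assumes "\<And>i. block_of U (\<sigma> \<langle>$\<rangle> i) = block_of U i"
  shows "iota U (perm_act \<sigma> f) = perm_act \<sigma> (iota U f)"
proof -
  have "iota U (perm_act \<sigma> f) = poly_eval (\<lambda>c. iota U (Const c)) (\<lambda>i. iota U (Var (\<sigma> \<langle>$\<rangle> i))) f"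
    unfolding perm_act_def by (rule ring_hom_of_poly_eval[OF ring_hom_iota])
  also have "\<dots> = poly_eval (\<lambda>c. perm_act \<sigma> (Const (conf_of_poly (Const c))))
      (\<lambda>i. perm_act \<sigma> (Const (conf_var (block_of U i)) + Var i)) f"
    by (simp add: perm_act_Const perm_act_Var iota_Const iota_Var
        ring_hom_add[OF ring_hom_perm_act] assms)
  also have "\<dots> = perm_act \<sigma> (iota U f)"
    unfolding iota_def by (rule ring_hom_of_poly_eval[OF ring_hom_perm_act, symmetric])
  finally show ?thesis .
qed

lemma vars_perm_act: "vars (perm_act \<sigma> f) \<subseteq> (\<langle>$\<rangle>) \<sigma> ` vars f"
  unfolding perm_act_def by (rule vars_poly_eval_subset) (auto simp: vars_Const vars_Var)

lemma vars_iota: "vars (iota U f) \<subseteq> vars f"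
  unfolding iota_def
proof (rule vars_poly_eval_subset)
  fix i assume "i \<in> vars f"
  then show "vars (Const (conf_var (block_of U i)) + Var i) \<subseteq> vars f"
    using vars_add[of "Const (conf_var (block_of U i))" "Var i"] by (auto simp: vars_Const vars_Var)
qed (simp add: vars_Const)

text \<open>The monomial \<open>m\<close> with its variables renamed by \<open>\<sigma>\<close>.\<close>

definition perm_mon :: "nat perm \<Rightarrow> (nat \<Rightarrow>\<^sub>0 nat) \<Rightarrow> nat \<Rightarrow>\<^sub>0 nat" where
  "perm_mon \<sigma> m = (\<Sum>v\<in>Poly_Mapping.keys m. Poly_Mapping.single (\<sigma> \<langle>$\<rangle> v) (Poly_Mapping.lookup m v))"

lemma lookup_perm_mon: "Poly_Mapping.lookup (perm_mon \<sigma> m) (\<sigma> \<langle>$\<rangle> v) = Poly_Mapping.lookup m v"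
  by (simp add: perm_mon_def lookup_sum lookup_single when_def inj_eq[OF bij_is_inj[OF bij_apply]] sum.delta
      in_keys_iff)

lemma inj_perm_mon: "inj (perm_mon \<sigma>)"
proof (rule injI)
  fix m n assume eq: "perm_mon \<sigma> m = perm_mon \<sigma> n"
  show "m = n"
  proof (rule poly_mapping_eqI)
    fix v
    show "Poly_Mapping.lookup m v = Poly_Mapping.lookup n v"
      using lookup_perm_mon[of \<sigma> m v] lookup_perm_mon[of \<sigma> n v] by (simp add: eq)
  qed
qed

lemma prod_single_1:
  "(\<Prod>x\<in>A. Poly_Mapping.single (f x) (1::'a::comm_ring_1)) = Poly_Mapping.single (\<Sum>x\<in>A. f x) 1"
  by (induction A rule: infinite_finite_induct) (simp_all add: mult_single)

lemma perm_act_single: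
  "perm_act \<sigma> (Poly_Mapping.single m c) = Poly_Mapping.single (perm_mon \<sigma> m) c"
  by (simp add: perm_act_def poly_eval_single[OF ring_hom_Const] Var_power prod_single_1
      perm_mon_def Const_def mult_single)

lemma lookup_perm_act:
  "Poly_Mapping.lookup (perm_act \<sigma> g) (perm_mon \<sigma> m) = Poly_Mapping.lookup g m"
proof (induction g rule: poly_mapping_single_induct)
  case (single n c)
  then show ?case
    by (simp add: perm_act_single lookup_single when_def inj_eq[OF inj_perm_mon])
next
  case (add p q)
  then show ?case by (simp add: ring_hom_add[OF ring_hom_perm_act] lookup_add)
qed


section \<open>Ideals cut out by conditions on coefficients\<close>

text \<open>The polynomials whose coefficients at the monomials in \<open>D\<close> lie in \<open>I\<close>. They form an ideal if
  \<open>I\<close> is an ideal and \<open>D\<close> is closed under taking divisors.\<close>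

definition coeffs_in :: "('v \<Rightarrow>\<^sub>0 nat) set \<Rightarrow> 'a set \<Rightarrow> ('v, 'a::comm_ring_1) mpoly set" where
  "coeffs_in D I = {g. \<forall>m\<in>D. Poly_Mapping.lookup g m \<in> I}"

lemma coeffs_in_times:
  assumes "is_ideal I"
    and "\<And>a b. a + b \<in> D \<Longrightarrow> Poly_Mapping.lookup f a \<in> I \<or> Poly_Mapping.lookup g b \<in> I"
  shows "f * g \<in> coeffs_in D I"
  unfolding coeffs_in_def
proof (intro CollectI ballI)
  fix m assume "m \<in> D"
  then have "(Poly_Mapping.lookup f a * Poly_Mapping.lookup g b when a + b = m) \<in> I" for a b
    using assms(2)[of a b]
    by (auto simp: when_def is_ideal_zero[OF assms(1)] is_ideal_mult_left[OF assms(1)]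
        is_ideal_mult_right[OF assms(1)])
  then show "Poly_Mapping.lookup (f * g) m \<in> I"
    unfolding lookup_times_sum by (intro is_ideal_sum assms(1))
qed

lemma is_ideal_coeffs_in:
  assumes "is_ideal I" and "\<And>a b. a + b \<in> D \<Longrightarrow> b \<in> D"
  shows "is_ideal (coeffs_in D I)"
  unfolding is_ideal_iff
proof (intro conjI ballI allI)
  fix c f assume "f \<in> coeffs_in D I"
  then show "c * f \<in> coeffs_in D I"
    using assms by (intro coeffs_in_times) (auto simp: coeffs_in_def)
qed (use assms(1) in \<open>auto simp: coeffs_in_def lookup_add is_ideal_zero is_ideal_add\<close>)

text \<open>The monomials not divisible by any \<open>v ^ w v\<close>.\<close>

definition small :: "('v \<Rightarrow> nat) \<Rightarrow> ('v \<Rightarrow>\<^sub>0 nat) set" where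
  "small w = {m. \<forall>v. Poly_Mapping.lookup m v < w v}"

lemma small_add: "a + b \<in> small w \<Longrightarrow> a \<in> small w" "a + b \<in> small w \<Longrightarrow> b \<in> small w"
  by (auto simp: small_def lookup_add intro: le_less_trans[OF le_add1] le_less_trans[OF le_add2])

text \<open>Every monomial outside \<open>small w\<close> is divisible by some generator \<open>v ^ w v\<close>, so only the
  coefficients at the monomials in \<open>small w\<close> matter for membership.\<close>

lemma ideal_gen_eq_coeffs_in:
  fixes I :: "'a::comm_ring_1 set" and w :: "'v \<Rightarrow> nat"
  assumes "is_ideal I"
  shows "ideal_gen (Const ` I \<union> {Var v ^ w v | v. True}) = coeffs_in (small w) I"
    (is "ideal_gen ?G = _")
proof
  show "ideal_gen ?G \<subseteq> coeffs_in (small w) I"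
  proof (rule ideal_gen_subset)
    show "is_ideal (coeffs_in (small w) I)"
      using assms by (rule is_ideal_coeffs_in) (rule small_add)
    show "?G \<subseteq> coeffs_in (small w) I"
      using is_ideal_zero[OF assms]
      by (fastforce simp: coeffs_in_def Const_def Var_power lookup_single when_def small_def)
  qed
  show "coeffs_in (small w) I \<subseteq> ideal_gen ?G"
  proof
    fix g assume g: "g \<in> coeffs_in (small w) I"
    have "Poly_Mapping.single m (Poly_Mapping.lookup g m) \<in> ideal_gen ?G" for m
    proof (cases "m \<in> small w")
      case True
      have "Poly_Mapping.single m (Poly_Mapping.lookup g m) =
          Poly_Mapping.single m 1 * Const (Poly_Mapping.lookup g m)"
        by (simp add: Const_def mult_single)
      moreover have "Poly_Mapping.lookup g m \<in> I"
        using True g by (simp add: coeffs_in_def)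
      ultimately show ?thesis
        using is_ideal_mult_left[OF is_ideal_ideal_gen[of ?G]] ideal_gen_base[of _ ?G] by force
    next
      case False
      then obtain v where v: "w v \<le> Poly_Mapping.lookup m v"
        by (auto simp: small_def not_less)
      have "m = (m - Poly_Mapping.single v (w v)) + Poly_Mapping.single v (w v)"
        using v by (intro poly_mapping_eqI) (auto simp: lookup_add lookup_minus lookup_single when_def)
      then have "Poly_Mapping.single m (Poly_Mapping.lookup g m) =
          Poly_Mapping.single (m - Poly_Mapping.single v (w v)) (Poly_Mapping.lookup g m) * Var v ^ w v"
        by (simp add: Var_power mult_single)
      moreover have "Var v ^ w v \<in> ideal_gen ?G"
        by (rule ideal_gen_base) blast
      ultimately show ?thesis
        using is_ideal_mult_left[OF is_ideal_ideal_gen[of ?G]] by simp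
    qed
    then have "(\<Sum>m\<in>Poly_Mapping.keys g. Poly_Mapping.single m (Poly_Mapping.lookup g m)) \<in> ideal_gen ?G"
      by (intro is_ideal_sum is_ideal_ideal_gen)
    then show "g \<in> ideal_gen ?G"
      by (simp add: sum_single_keys)
  qed
qed

text \<open>The monomials in \<open>small w\<close> of degree less than \<open>k\<close> in the variables from \<open>F\<close>.\<close>

definition small_below :: "('v \<Rightarrow> nat) \<Rightarrow> 'v set \<Rightarrow> nat \<Rightarrow> ('v \<Rightarrow>\<^sub>0 nat) set" where
  "small_below w F k = {m \<in> small w. (\<Sum>v\<in>F. Poly_Mapping.lookup m v) < k}"

lemma small_below_add: "a + b \<in> small_below w F k \<Longrightarrow> b \<in> small_below w F k"
  by (auto simp: small_below_def lookup_add sum.distrib dest: small_add)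

text \<open>A monomial of degree at most \<open>k\<close> in \<open>F\<close> factors only into pairs in which the first factor
  has degree 0 or the second has degree less than \<open>k\<close>.\<close>

lemma coeffs_in_small_below_times:
  assumes "is_ideal I" "f \<in> coeffs_in (small_below w F 1) I" "g \<in> coeffs_in (small_below w F k) I"
  shows "f * g \<in> coeffs_in (small_below w F (Suc k)) I"
proof (rule coeffs_in_times[OF assms(1)])
  fix a b assume ab: "a + b \<in> small_below w F (Suc k)"
  then have "a \<in> small w" "b \<in> small w"
    by (auto simp: small_below_def dest: small_add)
  moreover have "(\<Sum>v\<in>F. Poly_Mapping.lookup a v) + (\<Sum>v\<in>F. Poly_Mapping.lookup b v) < Suc k"
    using ab by (simp add: small_below_def lookup_add sum.distrib)
  ultimately have "a \<in> small_below w F 1 \<or> b \<in> small_below w F k"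
    unfolding small_below_def by (simp del: sum_eq_0_iff) linarith
  with assms(2,3) show "Poly_Mapping.lookup f a \<in> I \<or> Poly_Mapping.lookup g b \<in> I"
    by (auto simp: coeffs_in_def)
qed

lemma coeffs_in_small_below_eq:
  assumes "(\<Sum>v\<in>F. w v) < k"
  shows "coeffs_in (small_below w F k) I = coeffs_in (small w) I"
proof -
  have "(\<Sum>v\<in>F. Poly_Mapping.lookup m v) \<le> (\<Sum>v\<in>F. w v)" if "m \<in> small w" for m
    using that by (intro sum_mono) (auto simp: small_def less_imp_le)
  then have "small_below w F k = small w"
    using assms by (auto simp: small_below_def intro: le_less_trans)
  then show ?thesis by simp
qed

lemma coeffs_in_small_below_power:
  assumes "is_ideal I" "f \<in> coeffs_in (small_below w F 1) I"
  shows "f ^ k \<in> coeffs_in (small_below w F k) I"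
proof (induction k)
  case 0
  show ?case by (simp add: coeffs_in_def small_below_def)
next
  case (Suc k)
  then show ?case using coeffs_in_small_below_times[OF assms] by simp
qed

section \<open>Separating variables by permutations\<close>

lemma lookup_eq_0_of_vars:
  "vars p \<subseteq> V \<Longrightarrow> Poly_Mapping.lookup p m \<noteq> 0 \<Longrightarrow> v \<notin> V \<Longrightarrow> Poly_Mapping.lookup m v = 0"
  unfolding vars_subset_iff by (meson in_keys_iff subsetD)

text \<open>Suppose that \<open>\<sigma>\<close> maps \<open>F\<close> into itself and the translate of \<open>g\<close> by \<open>\<sigma>\<close> shares no variables outside \<open>F\<close> with \<open>q\<close>. Then a
  monomial free of the variables in \<open>F\<close> splits in at most one way into a monomial of the translate
  and a monomial of \<open>q\<close>.\<close>

lemma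
  fixes g q :: "(nat, 'a::comm_ring_1) mpoly"
  assumes stable: "\<And>i. i \<in> F \<Longrightarrow> \<sigma> \<langle>$\<rangle> i \<in> F"
    and sep: "\<And>i. i \<in> vars g \<Longrightarrow> i \<notin> F \<Longrightarrow> \<sigma> \<langle>$\<rangle> i \<notin> vars q"
    and m: "Poly_Mapping.lookup g m \<noteq> 0" "\<And>i. i \<in> F \<Longrightarrow> Poly_Mapping.lookup (perm_mon \<sigma> m) i = 0"
    and n: "Poly_Mapping.lookup q n \<noteq> 0" "\<And>i. i \<in> F \<Longrightarrow> Poly_Mapping.lookup n i = 0"
  shows lookup_perm_act_times: "Poly_Mapping.lookup (perm_act \<sigma> g * q) (perm_mon \<sigma> m + n) =
      Poly_Mapping.lookup g m * Poly_Mapping.lookup q n"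
    and perm_mon_separated: "Poly_Mapping.lookup (perm_mon \<sigma> m) i = 0 \<or> Poly_Mapping.lookup n i = 0"
proof -
  let ?p = "perm_act \<sigma> g"
  have cases: "i \<in> F \<or> i \<notin> (\<langle>$\<rangle>) \<sigma> ` vars g \<or> i \<notin> vars q" for i
    using stable sep by blast
  have p0: "Poly_Mapping.lookup a i = 0"
    if "Poly_Mapping.lookup ?p a \<noteq> 0" "i \<notin> (\<langle>$\<rangle>) \<sigma> ` vars g" for a i
    using lookup_eq_0_of_vars[OF vars_perm_act] that .
  have q0: "Poly_Mapping.lookup b i = 0" if "Poly_Mapping.lookup q b \<noteq> 0" "i \<notin> vars q" for b i
    using lookup_eq_0_of_vars[OF order_refl] that .
  have m': "Poly_Mapping.lookup ?p (perm_mon \<sigma> m) \<noteq> 0"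
    using m(1) by (simp add: lookup_perm_act)
  show "Poly_Mapping.lookup (perm_mon \<sigma> m) i = 0 \<or> Poly_Mapping.lookup n i = 0"
    using cases[of i] p0[OF m', of i] q0[OF n(1), of i] m(2)[of i] by argo
  have "a = perm_mon \<sigma> m \<and> b = n"
    if ab: "a + b = perm_mon \<sigma> m + n" "Poly_Mapping.lookup ?p a \<noteq> 0" "Poly_Mapping.lookup q b \<noteq> 0"
    for a b
  proof -
    have "Poly_Mapping.lookup a i = Poly_Mapping.lookup (perm_mon \<sigma> m) i" for i
    proof -
      have "Poly_Mapping.lookup a i + Poly_Mapping.lookup b i =
          Poly_Mapping.lookup (perm_mon \<sigma> m) i + Poly_Mapping.lookup n i"
        using arg_cong[OF ab(1), of "\<lambda>k. Poly_Mapping.lookup k i"] by (simp add: lookup_add)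
      with cases[of i] show ?thesis
        using p0[OF ab(2), of i] p0[OF m', of i] q0[OF ab(3), of i] q0[OF n(1), of i] m(2)[of i]
          n(2)[of i] by auto
    qed
    then have "a = perm_mon \<sigma> m" by (intro poly_mapping_eqI)
    with ab(1) show ?thesis by simp
  qed
  then have "Poly_Mapping.lookup (?p * q) (perm_mon \<sigma> m + n) =
      Poly_Mapping.lookup ?p (perm_mon \<sigma> m) * Poly_Mapping.lookup q n"
    by (rule lookup_times_unique)
  then show "Poly_Mapping.lookup (?p * q) (perm_mon \<sigma> m + n) =
      Poly_Mapping.lookup g m * Poly_Mapping.lookup q n"
    by (simp add: lookup_perm_act)
qed

lemma block_preserving_perm_exists:
  fixes b :: "nat \<Rightarrow> 'i"
  assumes "finite V" "finite W" and inf: "\<And>i. i \<in> V \<Longrightarrow> infinite {j. b j = b i}"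
  obtains \<sigma> where "\<And>i. b (\<sigma> \<langle>$\<rangle> i) = b i" and "\<And>i. i \<in> V \<Longrightarrow> \<sigma> \<langle>$\<rangle> i \<notin> W"
proof -
  have "\<exists>\<sigma>. (\<forall>i. b (\<sigma> \<langle>$\<rangle> i) = b i) \<and> (\<forall>i\<in>V. \<sigma> \<langle>$\<rangle> i \<notin> W)"
    using assms(1) inf
  proof (induction V)
    case empty
    show ?case by (rule exI[of _ 1]) simp
  next
    case (insert v V)
    then obtain \<sigma> where \<sigma>: "\<And>i. b (\<sigma> \<langle>$\<rangle> i) = b i" "\<And>i. i \<in> V \<Longrightarrow> \<sigma> \<langle>$\<rangle> i \<notin> W"
      by auto
    have "infinite ({j. b j = b v} - (W \<union> (\<langle>$\<rangle>) \<sigma> ` V))"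
      using insert assms(2) by (intro Diff_infinite_finite) auto
    \<comment> \<open>Correct \<open>\<sigma>\<close> by a transposition that sends the image of \<open>v\<close> to a fresh \<open>j\<close> in the same block.\<close>
    then obtain j where "j \<in> {j. b j = b v} - (W \<union> (\<langle>$\<rangle>) \<sigma> ` V)"
      using infinite_imp_nonempty by blast
    then have j: "b j = b v" "j \<notin> W" "j \<notin> (\<langle>$\<rangle>) \<sigma> ` V"
      by simp_all
    let ?\<tau> = "\<langle>\<sigma> \<langle>$\<rangle> v \<leftrightarrow> j\<rangle> * \<sigma>"
    have "b (?\<tau> \<langle>$\<rangle> i) = b i" for i
      using \<sigma>(1) j(1)
      by (cases "\<sigma> \<langle>$\<rangle> i = \<sigma> \<langle>$\<rangle> v"; cases "\<sigma> \<langle>$\<rangle> i = j") (auto simp: apply_times apply_inj)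
    moreover have "?\<tau> \<langle>$\<rangle> i \<notin> W" if "i \<in> insert v V" for i
    proof (cases "i = v")
      case True
      then show ?thesis using j by (simp add: apply_times)
    next
      case False
      then have "\<sigma> \<langle>$\<rangle> i \<noteq> j" "\<sigma> \<langle>$\<rangle> i \<noteq> \<sigma> \<langle>$\<rangle> v"
        using that j by (auto simp: apply_inj)
      then show ?thesis using \<sigma>(2) that False by (simp add: apply_times)
    qed
    ultimately show ?case by blast
  qed
  then show ?thesis using that by blast
qed


section \<open>Coefficients of elements of $\mathfrak{Q}$ and $\mathfrak{P}$\<close>

lemma frakQ_eq_coeffs_in:
  "Z \<subseteq> Spec \<Longrightarrow> frakQ U e Z = coeffs_in (small (\<lambda>i. e (block_of U i))) (ideal_of_pts Z)"
  unfolding frakQ_def by (intro ideal_gen_eq_coeffs_in is_ideal_ideal_of_pts)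

lemma is_ideal_frakQ: "is_ideal (frakQ U e Z)"
  unfolding frakQ_def by (rule is_ideal_ideal_gen)

lemma perm_act_1: "perm_act 1 f = f"
proof (induction f rule: poly_mapping_single_induct)
  case (single m c)
  have "perm_mon 1 m = m"
    by (rule poly_mapping_eqI) (use lookup_perm_mon[of 1 m] in simp)
  then show ?case by (simp add: perm_act_single)
qed (simp add: ring_hom_add[OF ring_hom_perm_act])

lemma is_ideal_iota_perm_act:
  assumes "is_ideal I"
  shows "is_ideal {f. \<forall>\<sigma>. iota U (perm_act \<sigma> f) \<in> I}"
  using assms unfolding is_ideal_iff
  by (simp add: ring_hom_zero[OF ring_hom_perm_act] ring_hom_add[OF ring_hom_perm_act]
      ring_hom_mult[OF ring_hom_perm_act] ring_hom_zero[OF ring_hom_iota]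
      ring_hom_add[OF ring_hom_iota] ring_hom_mult[OF ring_hom_iota])

lemma S_ideal_frakP: "S_ideal (frakP U e Z)"
  unfolding S_ideal_def frakP_def
  by (auto simp: is_ideal_iota_perm_act is_ideal_frakQ perm_act_perm_act)

lemma frakP_Union:
  assumes "\<And>j. j \<in> J \<Longrightarrow> Zf j \<subseteq> Spec"
  shows "frakP U e (\<Union>j\<in>J. Zf j) = (\<Inter>j\<in>J. frakP U e (Zf j))"
proof -
  have "(\<Union>j\<in>J. Zf j) \<subseteq> Spec" using assms by blast
  then show ?thesis
    using assms by (fastforce simp: frakP_def frakQ_eq_coeffs_in coeffs_in_def ideal_of_pts_def)
qed


section \<open>The radical\<close>

lemma iota_perm_act_power: "iota U (perm_act \<sigma> (f ^ n)) = iota U (perm_act \<sigma> f) ^ n"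
  by (simp add: ring_hom_power[OF ring_hom_perm_act] ring_hom_power[OF ring_hom_iota])

lemma radical_frakP:
  assumes e: "weighting e" and Z: "Z \<subseteq> Spec"
  shows "radical (frakP U e Z) = frakP U (\<lambda>_. 1) Z"
proof
  let ?w = "\<lambda>i. e (block_of U i)" and ?I = "ideal_of_pts Z"
  have I: "is_ideal ?I" by (rule is_ideal_ideal_of_pts[OF Z])
  have small_1: "m \<in> small (\<lambda>_. 1) \<longleftrightarrow> m = 0" for m :: "nat \<Rightarrow>\<^sub>0 nat"
    by (auto simp: small_def poly_mapping_eq_iff fun_eq_iff)
  have zero: "0 \<in> small ?w"
    using e by (auto simp: small_def weighting_def Suc_le_eq)
  show "radical (frakP U e Z) \<subseteq> frakP U (\<lambda>_. 1) Z"
  proof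
    fix f assume "f \<in> radical (frakP U e Z)"
    then obtain n where n: "f ^ n \<in> frakP U e Z" by (auto simp: radical_def)
    have "Poly_Mapping.lookup (iota U (perm_act \<sigma> f)) 0 \<in> ?I" for \<sigma>
    proof -
      have "Poly_Mapping.lookup (iota U (perm_act \<sigma> f) ^ n) 0 \<in> ?I"
        using n zero
        by (simp add: frakP_def frakQ_eq_coeffs_in[OF Z] coeffs_in_def iota_perm_act_power)
      then show ?thesis
        using ideal_of_pts_power[OF Z] by (simp add: lookup_power_zero)
    qed
    then show "f \<in> frakP U (\<lambda>_. 1) Z"
      by (simp add: frakP_def frakQ_eq_coeffs_in[OF Z] coeffs_in_def small_1 del: One_nat_def)
  qed
  show "frakP U (\<lambda>_. 1) Z \<subseteq> radical (frakP U e Z)"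
  proof
    fix f assume f: "f \<in> frakP U (\<lambda>_. 1) Z"
    \<comment> \<open>This bounds the sum of the weights over the image of \<open>vars f\<close> under any permutation.\<close>
    define k where "k = Suc (card (vars f) * Max (range e))"
    have "iota U (perm_act \<sigma> f) ^ k \<in> frakQ U e Z" for \<sigma>
    proof -
      let ?h = "iota U (perm_act \<sigma> f)" and ?F = "(\<langle>$\<rangle>) \<sigma> ` vars f"
      have vars: "vars ?h \<subseteq> ?F"
        using vars_iota vars_perm_act by (rule order_trans)
      \<comment> \<open>A monomial of degree 0 in \<open>?F\<close> either is constant or does not occur in \<open>?h\<close>.\<close>
      have h: "?h \<in> coeffs_in (small_below ?w ?F 1) ?I"
        unfolding coeffs_in_def
      proof (intro CollectI ballI)
        fix m assume m: "m \<in> small_below ?w ?F 1"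
        show "Poly_Mapping.lookup ?h m \<in> ?I"
        proof (cases "Poly_Mapping.lookup ?h m = 0")
          case True
          then show ?thesis by (simp add: is_ideal_zero[OF I])
        next
          case False
          have "Poly_Mapping.lookup m i = 0" for i
          proof (cases "i \<in> ?F")
            case True
            then show ?thesis using m by (auto simp: small_below_def finite_vars)
          next
            case False
            then show ?thesis
              using lookup_eq_0_of_vars[OF vars \<open>Poly_Mapping.lookup ?h m \<noteq> 0\<close>] by blast
          qed
          then have "m \<in> small (\<lambda>_. 1)" by (simp add: small_def)
          with f show ?thesis
            by (simp add: frakP_def frakQ_eq_coeffs_in[OF Z] coeffs_in_def)
        qed
      qed
      have "(\<Sum>i\<in>?F. ?w i) \<le> card ?F * Max (range e)"
        by (rule sum_bounded_above[where 'a = nat, simplified]) simp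
      also have "\<dots> \<le> card (vars f) * Max (range e)"
        by (intro mult_right_mono card_image_le finite_vars) simp
      finally have "(\<Sum>i\<in>?F. ?w i) < k" by (simp add: k_def)
      then show ?thesis
        using coeffs_in_small_below_power[OF I h, of k]
        by (simp add: coeffs_in_small_below_eq frakQ_eq_coeffs_in[OF Z])
    qed
    then have "f ^ k \<in> frakP U e Z"
      by (simp add: frakP_def iota_perm_act_power)
    then show "f \<in> radical (frakP U e Z)"
      by (auto simp: radical_def)
  qed
qed


section \<open>The $\mathfrak{S}$-radical\<close>

context
  fixes lam :: "'i::finite \<Rightarrow> enat" and e :: "'i \<Rightarrow> nat" and U :: "'i \<Rightarrow> nat set"
    and Z :: "('i, 'a::comm_ring_1) conf_ring set set"
  assumes e: "weighting e" and U: "partition_of_type lam U" and Z: "Z \<subseteq> Spec"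
begin

lemma mem_block_iff: "i \<in> U \<alpha> \<longleftrightarrow> block_of U i = \<alpha>"
proof -
  have "i \<in> (\<Union>\<alpha>. U \<alpha>)"
    using U by (simp add: partition_of_type_def)
  then obtain \<beta> where "i \<in> U \<beta>" by blast
  moreover have "\<gamma> = \<delta>" if "i \<in> U \<gamma>" "i \<in> U \<delta>" for \<gamma> \<delta>
    using U that by (auto simp: partition_of_type_def disjoint_family_on_def)
  ultimately have "block_of U i = \<beta>" "i \<in> U \<alpha> \<longleftrightarrow> \<alpha> = \<beta>"
    unfolding block_of_def by (blast intro: the_equality)+
  then show ?thesis by auto
qed

lemma finite_block_iff: "finite (U \<alpha>) \<longleftrightarrow> lam \<alpha> \<noteq> \<infinity>"
proof -
  have "lam \<alpha> = ecard (U \<alpha>)"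
    using U by (simp add: partition_of_type_def)
  then show ?thesis by (simp add: ecard_def)
qed

text \<open>The indices that lie in finite blocks.\<close>

definition fin_part :: "nat set" where
  "fin_part = {i. lam (block_of U i) \<noteq> \<infinity>}"

lemma finite_fin_part: "finite fin_part"
proof -
  have "fin_part = (\<Union>\<alpha>\<in>{\<alpha>. lam \<alpha> \<noteq> \<infinity>}. U \<alpha>)"
    by (auto simp: fin_part_def mem_block_iff)
  then show ?thesis by (auto simp: finite_block_iff)
qed

lemma infinite_block: "i \<notin> fin_part \<Longrightarrow> infinite {j. block_of U j = block_of U i}"
  using finite_block_iff[of "block_of U i"] by (simp add: fin_part_def mem_block_iff[symmetric])

text \<open>The reduced weight is 1 on finite blocks, so a monomial is small for it only if it does not
  involve them.\<close>

lemma small_red_iff: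
  "m \<in> small (\<lambda>i. red lam e (block_of U i)) \<longleftrightarrow>
    m \<in> small (\<lambda>i. e (block_of U i)) \<and> (\<forall>i\<in>fin_part. Poly_Mapping.lookup m i = 0)"
proof -
  have "Poly_Mapping.lookup m i < red lam e (block_of U i) \<longleftrightarrow>
      Poly_Mapping.lookup m i < e (block_of U i) \<and> (i \<in> fin_part \<longrightarrow> Poly_Mapping.lookup m i = 0)" for i
  proof -
    have "1 \<le> e (block_of U i)"
      using e by (simp add: weighting_def)
    then show ?thesis
      by (auto simp: fin_part_def red_def)
  qed
  then show ?thesis
    unfolding small_def by blast
qed

lemma ideal_power_frakP_red_subset:
  "ideal_power (frakP U (red lam e) Z) k \<subseteq>
    {f. \<forall>\<sigma>. iota U (perm_act \<sigma> f) \<in>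
      coeffs_in (small_below (\<lambda>i. e (block_of U i)) fin_part k) (ideal_of_pts Z)}"
proof (induction k)
  case 0
  show ?case by (simp add: coeffs_in_def small_below_def)
next
  case (Suc k)
  have I: "is_ideal (ideal_of_pts Z)"
    by (rule is_ideal_ideal_of_pts[OF Z])
  have "small_below (\<lambda>i. e (block_of U i)) fin_part 1 \<subseteq> small (\<lambda>i. red lam e (block_of U i))"
    by (auto simp: small_below_def small_red_iff finite_fin_part)
  then have 1: "iota U (perm_act \<sigma> f) \<in>
      coeffs_in (small_below (\<lambda>i. e (block_of U i)) fin_part 1) (ideal_of_pts Z)"
    if "f \<in> frakP U (red lam e) Z" for f \<sigma>
    using that by (auto simp: frakP_def frakQ_eq_coeffs_in[OF Z] coeffs_in_def)
  show ?case
    unfolding ideal_power.simps ideal_mult_def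
  proof (rule ideal_gen_subset)
    show "is_ideal {f. \<forall>\<sigma>. iota U (perm_act \<sigma> f) \<in>
        coeffs_in (small_below (\<lambda>i. e (block_of U i)) fin_part (Suc k)) (ideal_of_pts Z)}"
      by (intro is_ideal_iota_perm_act is_ideal_coeffs_in I) (rule small_below_add)
    have "x * y \<in> {f. \<forall>\<sigma>. iota U (perm_act \<sigma> f) \<in>
        coeffs_in (small_below (\<lambda>i. e (block_of U i)) fin_part (Suc k)) (ideal_of_pts Z)}"
      if "x \<in> frakP U (red lam e) Z" "y \<in> ideal_power (frakP U (red lam e) Z) k" for x y
    proof (intro CollectI allI)
      fix \<sigma>
      have "iota U (perm_act \<sigma> y) \<in>
          coeffs_in (small_below (\<lambda>i. e (block_of U i)) fin_part k) (ideal_of_pts Z)"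
        using Suc that(2) by blast
      then show "iota U (perm_act \<sigma> (x * y)) \<in>
          coeffs_in (small_below (\<lambda>i. e (block_of U i)) fin_part (Suc k)) (ideal_of_pts Z)"
        unfolding ring_hom_mult[OF ring_hom_perm_act] ring_hom_mult[OF ring_hom_iota]
        by (rule coeffs_in_small_below_times[OF I 1[OF that(1)]])
    qed
    then show "{x * y |x y. x \<in> frakP U (red lam e) Z \<and>
          y \<in> ideal_power (frakP U (red lam e) Z) k} \<subseteq>
        {f. \<forall>\<sigma>. iota U (perm_act \<sigma> f) \<in>
          coeffs_in (small_below (\<lambda>i. e (block_of U i)) fin_part (Suc k)) (ideal_of_pts Z)}"
      by blast
  qed
qed

lemma frakP_red_power_subset: "\<exists>k. ideal_power (frakP U (red lam e) Z) k \<subseteq> frakP U e Z"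
proof
  show "ideal_power (frakP U (red lam e) Z) (Suc (\<Sum>i\<in>fin_part. e (block_of U i))) \<subseteq> frakP U e Z"
    using ideal_power_frakP_red_subset[of "Suc (\<Sum>i\<in>fin_part. e (block_of U i))"]
    unfolding coeffs_in_small_below_eq[OF lessI] frakP_def[of U e] frakQ_eq_coeffs_in[OF Z] .
qed

text \<open>The power of \<open>J\<close> is climbed by multiplying with a translate of \<open>f\<close> whose variables in infinite
  blocks are new. The monomials of the two factors then have disjoint supports, so that their
  product stays small, and the coefficients multiply.\<close>

lemma ideal_power_lookup_notin_prime:
  assumes J: "S_ideal J" "f \<in> J" and P: "prime_ideal P"
    and m: "m \<in> small (\<lambda>i. red lam e (block_of U i))" "Poly_Mapping.lookup (iota U f) m \<notin> P"
  shows "\<exists>q\<in>ideal_power J k. \<exists>n\<in>small (\<lambda>i. red lam e (block_of U i)).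
    Poly_Mapping.lookup (iota U q) n \<notin> P"
proof (induction k)
  case 0
  have "0 \<in> small (\<lambda>i. red lam e (block_of U i))"
    using small_add(1)[of 0 m] m(1) by simp
  moreover have "Poly_Mapping.lookup (iota U 1) 0 \<notin> P"
    using P by (simp add: ring_hom_one[OF ring_hom_iota] prime_ideal_def)
  ultimately show ?case by (intro bexI[of _ 1] bexI[of _ 0]) simp_all
next
  case (Suc k)
  then obtain q n where q: "q \<in> ideal_power J k"
    and n: "n \<in> small (\<lambda>i. red lam e (block_of U i))" "Poly_Mapping.lookup (iota U q) n \<notin> P"
    by blast
  have fin: "finite (vars (iota U f) - fin_part)" "finite (vars (iota U q))"
    by (simp_all add: finite_vars)
  have inf: "infinite {j. block_of U j = block_of U i}" if "i \<in> vars (iota U f) - fin_part" for i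
    using that infinite_block by blast
  obtain \<sigma> where \<sigma>: "\<And>i. block_of U (\<sigma> \<langle>$\<rangle> i) = block_of U i"
    and sep: "\<And>i. i \<in> vars (iota U f) - fin_part \<Longrightarrow> \<sigma> \<langle>$\<rangle> i \<notin> vars (iota U q)"
    by (rule block_preserving_perm_exists[OF fin inf]) (assumption, rule that)
  have \<sigma>m: "perm_mon \<sigma> m \<in> small (\<lambda>i. red lam e (block_of U i))"
    unfolding small_def
  proof (intro CollectI allI)
    fix i
    obtain j where "i = \<sigma> \<langle>$\<rangle> j"
      using bij_apply[of \<sigma>] by (metis bij_pointE)
    then show "Poly_Mapping.lookup (perm_mon \<sigma> m) i < red lam e (block_of U i)"
      using m(1) by (simp add: lookup_perm_mon \<sigma> small_def)
  qed
  have P0: "0 \<in> P"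
    using P is_ideal_zero by (auto simp: prime_ideal_def)
  have stable: "\<sigma> \<langle>$\<rangle> i \<in> fin_part" if "i \<in> fin_part" for i
    using that \<sigma> by (simp add: fin_part_def)
  have sep': "\<sigma> \<langle>$\<rangle> i \<notin> vars (iota U q)" if "i \<in> vars (iota U f)" "i \<notin> fin_part" for i
    using sep that by blast
  have m0: "Poly_Mapping.lookup (iota U f) m \<noteq> 0"
    and n0: "Poly_Mapping.lookup (iota U q) n \<noteq> 0"
    using m(2) n(2) P0 by auto
  have m1: "Poly_Mapping.lookup (perm_mon \<sigma> m) i = 0"
    and n1: "Poly_Mapping.lookup n i = 0" if "i \<in> fin_part" for i
    using that \<sigma>m n(1) by (simp_all add: small_red_iff)
  have "perm_act \<sigma> f * q \<in> ideal_power J (Suc k)"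
    unfolding ideal_power.simps ideal_mult_def
    using J q by (intro ideal_gen_base) (auto simp: S_ideal_def)
  moreover have "perm_mon \<sigma> m + n \<in> small (\<lambda>i. red lam e (block_of U i))"
    using perm_mon_separated[OF stable sep' m0 m1 n0 n1] \<sigma>m n(1)
    by (auto simp: small_def lookup_add) (metis add.right_neutral add_0)
  moreover have "Poly_Mapping.lookup (iota U (perm_act \<sigma> f * q)) (perm_mon \<sigma> m + n) =
      Poly_Mapping.lookup (iota U f) m * Poly_Mapping.lookup (iota U q) n"
    unfolding ring_hom_mult[OF ring_hom_iota] iota_perm_act[OF \<sigma>]
    by (rule lookup_perm_act_times[OF stable sep' m0 m1 n0 n1])
  ultimately show ?case
    using P m(2) n(2) unfolding prime_ideal_def by metis
qed

lemma subset_frakP_red: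
  assumes J: "S_ideal J" "ideal_power J k \<subseteq> frakP U e Z"
  shows "J \<subseteq> frakP U (red lam e) Z"
proof
  fix f assume f: "f \<in> J"
  have "Poly_Mapping.lookup (iota U (perm_act \<sigma> f)) m \<in> P"
    if m: "m \<in> small (\<lambda>i. red lam e (block_of U i))" and P: "P \<in> Z" for \<sigma> m P
  proof (rule ccontr)
    assume "Poly_Mapping.lookup (iota U (perm_act \<sigma> f)) m \<notin> P"
    moreover have "perm_act \<sigma> f \<in> J"
      using J(1) f by (simp add: S_ideal_def)
    moreover have "prime_ideal P"
      using P Z by (auto simp: Spec_def)
    ultimately obtain q n where "q \<in> ideal_power J k"
      and n: "n \<in> small (\<lambda>i. red lam e (block_of U i))" "Poly_Mapping.lookup (iota U q) n \<notin> P"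
      using ideal_power_lookup_notin_prime[OF J(1) _ _ m] by blast
    then have "iota U (perm_act 1 q) \<in> frakQ U e Z"
      using J(2) by (auto simp: frakP_def)
    then have "Poly_Mapping.lookup (iota U q) n \<in> ideal_of_pts Z"
      using n(1) by (simp add: perm_act_1 frakQ_eq_coeffs_in[OF Z] coeffs_in_def small_red_iff)
    with n(2) P show False by (auto simp: ideal_of_pts_def)
  qed
  then show "f \<in> frakP U (red lam e) Z"
    by (auto simp: frakP_def frakQ_eq_coeffs_in[OF Z] coeffs_in_def ideal_of_pts_def)
qed

lemma S_radical_frakP: "S_radical (frakP U e Z) = frakP U (red lam e) Z"
proof
  show "S_radical (frakP U e Z) \<subseteq> frakP U (red lam e) Z"
    unfolding S_radical_def
  proof (rule ideal_gen_subset)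
    show "is_ideal (frakP U (red lam e) Z)"
      using S_ideal_frakP by (auto simp: S_ideal_def)
  qed (use subset_frakP_red in blast)
  show "frakP U (red lam e) Z \<subseteq> S_radical (frakP U e Z)"
    unfolding S_radical_def
    using frakP_red_power_subset S_ideal_frakP by (blast intro: ideal_gen_base)
qed

end

theorem proposition3p17:
  fixes lam :: "'i::finite \<Rightarrow> enat"
    and e :: "'i \<Rightarrow> nat"
    and U :: "'i \<Rightarrow> nat set"
    and Z :: "('i, 'a::comm_ring_1) conf_ring set set"
  assumes "inf_composition lam"
    and "weighting e"
    and "partition_of_type lam U"
    and "Z \<subseteq> Spec"
  shows "radical (frakP U e Z) = frakP U (\<lambda>_. 1) Z \<and>
         S_radical (frakP U e Z) = frakP U (red lam e) Z \<and>
         (\<forall>(J :: 'j set) Zf. Z = (\<Union>j\<in>J. Zf j) \<longrightarrow>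
            frakP U e Z = (\<Inter>j\<in>J. frakP U e (Zf j)))"
proof (intro conjI allI impI)
  show "radical (frakP U e Z) = frakP U (\<lambda>_. 1) Z"
    using assms(2,4) by (rule radical_frakP)
  show "S_radical (frakP U e Z) = frakP U (red lam e) Z"
    using assms(2-4) by (rule S_radical_frakP)
  fix J :: "'j set" and Zf
  assume "Z = (\<Union>j\<in>J. Zf j)"
  with assms(4) show "frakP U e Z = (\<Inter>j\<in>J. frakP U e (Zf j))"
    using frakP_Union[of J Zf U e] by blast
qed

end
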